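(* Let $A_1,\dots,A_m,C$ be real symmetric $n\times n$ matrices and $b\in\mathbb{R}^m$, let $(\mathcal{P},\mathcal{D})$ be the associated primal-dual pair of semidefinite programs, let $M$ be a solution bound for $(\mathcal{P},\mathcal{D})$, and let $G_M$ be the corresponding modified semidefinite Dantzig game. Then a pair $(X,y)$ of strongly optimal solutions of $(\mathcal{P},\mathcal{D})$ exists if and only if the value of the game $G_M$ is zero. Furthermore, if the value of $G_M$ is zero, then any optimal strategy of the second player for $G_M$ is of the form $\operatorname{diag}(X,y,t)$ with $t>0$, and $\frac1t X$, $\frac1t y$ are strongly optimal solutions for $(\mathcal{P},\mathcal{D})$.
   Context: $\mathcal{S}_n$ is the space of real symmetric $n\times n$ matrices, $\mathcal{S}_n^+$ the cone of positive semidefinite ones, $\succeq,\preceq$ the Loewner order, $\langle A,B\rangle=\operatorname{tr}(AB)$, $\mathbf{1}$ the all-ones vector, $[m]=\{1,\dots,m\}$. Primal-dual pair: $\mathcal{P}:\ \inf_X\{\langle C,X\rangle : \langle A_i,X\rangle\ge b_i,\ i\in[m],\ X\in\mathcal{S}_n^+\}$ and $\mathcal{D}:\ \sup_y\{b^Ty : \sum_{i=1}^m y_iA_i\preceq C,\ y\in\mathbb{R}^m_+\}$. A pair $(X,y)\in\mathcal{S}_n^+\times\mathbb{R}^m_+$ is strongly optimal for $(\mathcal{P},\mathcal{D})$ if $X$ is feasible for $\mathcal{P}$, $y$ is feasible for $\mathcal{D}$, and $\langle C,X\rangle-b^Ty\le 0$ (equivalently, by weak duality, both are optimal and the optimal values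 coincide). Auxiliary SDP: $\mathcal{P}_{\mathrm{aux}}$ is the problem $\inf w$ subject to $\langle A_i,X\rangle+w\ge b_i$ for $i\in[m]$, $\sum_{i=1}^m y_iA_i-wI_n\preceq C$, $\langle C,X\rangle-b^Ty-w\le 0$, $X\succeq 0$, $y\ge 0$, $w\ge 0$, in the variables $(X,y,w)\in\mathcal{S}_n\times\mathbb{R}^m\times\mathbb{R}$. Solution bound: if the infimum of $\mathcal{P}_{\mathrm{aux}}$ is attained, a solution bound is any $M>0$ such that $\operatorname{tr}(X^* )+\mathbf{1}^Ty^*+1\le M$ holds for some optimal solution $(X^*,y^*,w^* )$ of $\mathcal{P}_{\mathrm{aux}}$; if the infimum is not attained, any $M>0$ is a solution bound. Modified semidefinite Dantzig game $G_M$: a zero-sum game. Strategies of the first player are block-diagonal matrices $\bar X=\operatorname{diag}(X^{(1)},y^{(1)},t^{(1)},u)$ (diagonal blocks $X^{(1)}$, $\operatorname{diag}(y^{(1)})$, $t^{(1)}$, $u$) with $X^{(1)}\in\mathcal{S}_n^+$, $y^{(1)}\in\mathbb{R}^m_+$, $t^{(1)}\ge0$, $u\ge 0$ and $\operatorname{tr}(\bar X)=1$. Strategies of the second player are block-diagonal matrices $\bar Y=\operatorname{diag}(X^{(2)},y^{(2)},t^{(2)})$ with $X^{(2)}\in\mathcal{S}_n^+$, $y^{(2)}\in\mathbb{R}^m_+$, $t^{(2)}\ge0$ and $\operatorname{tr}(\bar Y)=1$. (The game is formally a semidefinite game on $\mathcal{S}_{n+m+2}\times\mathcal{S}_{n+m+1}$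 with payoff tensor vanishing outside these blocks; strategies are identified with their block-diagonal parts.) The payoff to the first player (who maximizes; the second player receives the negative) is $$p(\bar X,\bar Y)=\sum_{i=1}^m y^{(1)}_i\bigl(t^{(2)}b_i-\langle A_i,X^{(2)}\rangle\bigr)+\Bigl\langle X^{(1)},\sum_{i=1}^m y^{(2)}_iA_i-t^{(2)}C\Bigr\rangle+t^{(1)}\bigl(\langle C,X^{(2)}\rangle-b^Ty^{(2)}\bigr)+u\bigl(\operatorname{tr}(X^{(2)})+\mathbf{1}^Ty^{(2)}-t^{(2)}M\bigr).$$ The value is $v=\max_{\bar X}\min_{\bar Y}p(\bar X,\bar Y)=\min_{\bar Y}\max_{\bar X}p(\bar X,\bar Y)$; a strategy of a player is optimal if it attains the corresponding outer optimum, i.e. guarantees that player the value. *)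

theory Defs
  imports "HOL-Analysis.Analysis"
begin

section \<open>Symmetric and positive semidefinite matrices\<close>

definition sym_mat :: "real^'n^'n \<Rightarrow> bool" where
  "sym_mat A \<longleftrightarrow> transpose A = A"

definition psd :: "real^'n^'n \<Rightarrow> bool" where
  "psd A \<longleftrightarrow> sym_mat A \<and> (\<forall>x. 0 \<le> x \<bullet> (A *v x))"

definition loewner_le :: "real^'n^'n \<Rightarrow> real^'n^'n \<Rightarrow> bool"  (infix "\<preceq>\<^sub>L" 50) where
  "A \<preceq>\<^sub>L B \<longleftrightarrow> psd (B - A)"

definition mat_inner :: "real^'n^'n \<Rightarrow> real^'n^'n \<Rightarrow> real" where
  "mat_inner A B = trace (A ** B)"

definition nonneg_vec :: "real^'m \<Rightarrow> bool" where
  "nonneg_vec y \<longleftrightarrow> (\<forall>i. 0 \<le> y $ i)"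

section \<open>The primal-dual pair and the auxiliary problem\<close>

definition primal_feasible :: "('m \<Rightarrow> real^'n^'n) \<Rightarrow> real^'m \<Rightarrow> real^'n^'n \<Rightarrow> bool" where
  "primal_feasible A b X \<longleftrightarrow> psd X \<and> (\<forall>i. b $ i \<le> mat_inner (A i) X)"

definition dual_feasible :: "('m \<Rightarrow> real^'n^'n) \<Rightarrow> real^'n^'n \<Rightarrow> real^'m \<Rightarrow> bool" where
  "dual_feasible A C y \<longleftrightarrow> nonneg_vec y \<and> (\<Sum>i\<in>UNIV. y $ i *\<^sub>R A i) \<preceq>\<^sub>L C"

definition strongly_optimal ::
  "('m \<Rightarrow> real^'n^'n) \<Rightarrow> real^'m \<Rightarrow> real^'n^'n \<Rightarrow> real^'n^'n \<Rightarrow> real^'m \<Rightarrow> bool" where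
  "strongly_optimal A b C X y \<longleftrightarrow>
     primal_feasible A b X \<and> dual_feasible A C y \<and> mat_inner C X - b \<bullet> y \<le> 0"

definition aux_feasible ::
  "('m \<Rightarrow> real^'n^'n) \<Rightarrow> real^'m \<Rightarrow> real^'n^'n \<Rightarrow> real^'n^'n \<Rightarrow> real^'m \<Rightarrow> real \<Rightarrow> bool" where
  "aux_feasible A b C X y w \<longleftrightarrow>
     (\<forall>i. b $ i \<le> mat_inner (A i) X + w) \<and>
     (\<Sum>i\<in>UNIV. y $ i *\<^sub>R A i) - w *\<^sub>R mat 1 \<preceq>\<^sub>L C \<and>
     mat_inner C X - b \<bullet> y - w \<le> 0 \<and>
     psd X \<and> nonneg_vec y \<and> 0 \<le> w"

definition aux_optimal ::
  "('m \<Rightarrow> real^'n^'n) \<Rightarrow> real^'m \<Rightarrow> real^'n^'n \<Rightarrow> real^'n^'n \<Rightarrow> real^'m \<Rightarrow> real \<Rightarrow> bool" where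
  "aux_optimal A b C X y w \<longleftrightarrow>
     aux_feasible A b C X y w \<and> (\<forall>X' y' w'. aux_feasible A b C X' y' w' \<longrightarrow> w \<le> w')"

text \<open>The infimum of the auxiliary problem is attained iff an optimal solution exists.\<close>

definition solution_bound ::
  "('m \<Rightarrow> real^'n^'n) \<Rightarrow> real^'m \<Rightarrow> real^'n^'n \<Rightarrow> real \<Rightarrow> bool" where
  "solution_bound A b C M \<longleftrightarrow> 0 < M \<and>
     ((\<exists>X y w. aux_optimal A b C X y w) \<longrightarrow>
      (\<exists>X y w. aux_optimal A b C X y w \<and> trace X + (\<Sum>i\<in>UNIV. y $ i) + 1 \<le> M))"

section \<open>Zero-sum games\<close>

text \<open>
  \<open>S\<close> and \<open>T\<close> are the strategy sets of the maximizing and of the minimizing player, \<open>p\<close> is the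
  payoff to the former. For nonempty compact \<open>S\<close>, \<open>T\<close> and continuous \<open>p\<close>, as in the game below,
  all suprema and infima are finite and attained, so they are the maxima and minima of the
  usual definition (on unbounded sets of reals \<open>Sup\<close> and \<open>Inf\<close> would be unspecified).
\<close>

definition max_min :: "'s set \<Rightarrow> 't set \<Rightarrow> ('s \<Rightarrow> 't \<Rightarrow> real) \<Rightarrow> real" where
  "max_min S T p = (SUP x\<in>S. INF y\<in>T. p x y)"

definition min_max :: "'s set \<Rightarrow> 't set \<Rightarrow> ('s \<Rightarrow> 't \<Rightarrow> real) \<Rightarrow> real" where
  "min_max S T p = (INF y\<in>T. SUP x\<in>S. p x y)"

definition has_game_value :: "'s set \<Rightarrow> 't set \<Rightarrow> ('s \<Rightarrow> 't \<Rightarrow> real) \<Rightarrow> real \<Rightarrow> bool" where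
  "has_game_value S T p v \<longleftrightarrow> max_min S T p = v \<and> min_max S T p = v"

definition optimal_second :: "'s set \<Rightarrow> 't set \<Rightarrow> ('s \<Rightarrow> 't \<Rightarrow> real) \<Rightarrow> 't \<Rightarrow> bool" where
  "optimal_second S T p y \<longleftrightarrow> y \<in> T \<and> (SUP x\<in>S. p x y) = min_max S T p"

section \<open>Block-diagonal matrices\<close>

definition block_diag :: "real^'a^'a \<Rightarrow> real^'b^'b \<Rightarrow> real^('a::finite + 'b::finite)^('a + 'b)" where
  "block_diag P Q = (\<chi> i j. case (i, j) of
      (Inl k, Inl l) \<Rightarrow> P $ k $ l
    | (Inr k, Inr l) \<Rightarrow> Q $ k $ l
    | _ \<Rightarrow> 0)"

definition diag_mat :: "real^'m \<Rightarrow> real^'m^'m" where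
  "diag_mat y = (\<chi> i j. if i = j then y $ i else 0)"

text \<open>A scalar block \<open>s\<close> is the \<open>1 \<times> 1\<close> matrix \<^term>\<open>mat s :: real^1^1\<close>.\<close>

definition diag3 :: "real^'n^'n \<Rightarrow> real^'m \<Rightarrow> real \<Rightarrow> real^('n::finite + 'm::finite + 1)^('n + 'm + 1)" where
  "diag3 X y t = block_diag X (block_diag (diag_mat y) (mat t))"

definition diag4 ::
  "real^'n^'n \<Rightarrow> real^'m \<Rightarrow> real \<Rightarrow> real \<Rightarrow> real^('n::finite + 'm::finite + 1 + 1)^('n + 'm + 1 + 1)" where
  "diag4 X y t u = block_diag X (block_diag (diag_mat y) (block_diag (mat t) (mat u)))"

text \<open>
  The blocks are read back off a matrix. Since \<open>+\<close> on types associates to the right,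
  \<open>X_part\<close> and \<open>y_part\<close> apply to both shapes.
\<close>

definition X_part :: "real^('n::finite + 'r::finite)^('n + 'r) \<Rightarrow> real^'n^'n" where
  "X_part Z = (\<chi> i j. Z $ Inl i $ Inl j)"

definition y_part :: "real^('n::finite + 'm::finite + 'r::finite)^('n + 'm + 'r) \<Rightarrow> real^'m" where
  "y_part Z = (\<chi> i. Z $ Inr (Inl i) $ Inr (Inl i))"

definition t_part3 :: "real^('n::finite + 'm::finite + 1)^('n + 'm + 1) \<Rightarrow> real" where
  "t_part3 Z = Z $ Inr (Inr 1) $ Inr (Inr 1)"

definition t_part4 :: "real^('n::finite + 'm::finite + 1 + 1)^('n + 'm + 1 + 1) \<Rightarrow> real" where
  "t_part4 Z = Z $ Inr (Inr (Inl 1)) $ Inr (Inr (Inl 1))"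

definition u_part4 :: "real^('n::finite + 'm::finite + 1 + 1)^('n + 'm + 1 + 1) \<Rightarrow> real" where
  "u_part4 Z = Z $ Inr (Inr (Inr 1)) $ Inr (Inr (Inr 1))"

lemma parts_diag3 [simp]:
  "X_part (diag3 X y t) = X"
  "y_part (diag3 X y t) = y"
  "t_part3 (diag3 X y t) = t"
  by (simp_all add: X_part_def y_part_def t_part3_def diag3_def block_diag_def diag_mat_def
      mat_def vec_eq_iff)

lemma parts_diag4 [simp]:
  "X_part (diag4 X y t u) = X"
  "y_part (diag4 X y t u) = y"
  "t_part4 (diag4 X y t u) = t"
  "u_part4 (diag4 X y t u) = u"
  by (simp_all add: X_part_def y_part_def t_part4_def u_part4_def diag4_def block_diag_def
      diag_mat_def mat_def vec_eq_iff)

section \<open>The modified semidefinite Dantzig game\<close>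

definition strategies1 :: "(real^('n::finite + 'm::finite + 1 + 1)^('n + 'm + 1 + 1)) set" where
  "strategies1 = {diag4 X y t u | X y t u.
     psd X \<and> nonneg_vec y \<and> 0 \<le> t \<and> 0 \<le> u \<and> trace (diag4 X y t u) = 1}"

definition strategies2 :: "(real^('n::finite + 'm::finite + 1)^('n + 'm + 1)) set" where
  "strategies2 = {diag3 X y t | X y t.
     psd X \<and> nonneg_vec y \<and> 0 \<le> t \<and> trace (diag3 X y t) = 1}"

definition payoff ::
  "('m \<Rightarrow> real^'n^'n) \<Rightarrow> real^'m \<Rightarrow> real^'n^'n \<Rightarrow> real \<Rightarrow>
   real^('n::finite + 'm::finite + 1 + 1)^('n + 'm + 1 + 1) \<Rightarrow> real^('n::finite + 'm::finite + 1)^('n + 'm + 1) \<Rightarrow> real" where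
  "payoff A b C M Z W =
    (let X1 = X_part Z; y1 = y_part Z; t1 = t_part4 Z; u = u_part4 Z;
         X2 = X_part W; y2 = y_part W; t2 = t_part3 W
     in (\<Sum>i\<in>UNIV. y1 $ i * (t2 * b $ i - mat_inner (A i) X2))
        + mat_inner X1 ((\<Sum>i\<in>UNIV. y2 $ i *\<^sub>R A i) - t2 *\<^sub>R C)
        + t1 * (mat_inner C X2 - b \<bullet> y2)
        + u * (trace X2 + (\<Sum>i\<in>UNIV. y2 $ i) - t2 * M))"

definition dantzig_game_value ::
  "('m \<Rightarrow> real^'n^'n) \<Rightarrow> real^'m \<Rightarrow> real^'n^'n \<Rightarrow> real \<Rightarrow> real \<Rightarrow> bool" where
  "dantzig_game_value A b C M v \<longleftrightarrow>
     has_game_value strategies1 strategies2 (payoff A b C M) v"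

definition dantzig_optimal_second ::
  "('m \<Rightarrow> real^'n^'n) \<Rightarrow> real^'m \<Rightarrow> real^'n^'n \<Rightarrow> real \<Rightarrow>
   real^('n::finite + 'm::finite + 1)^('n + 'm + 1) \<Rightarrow> bool" where
  "dantzig_optimal_second A b C M W \<longleftrightarrow>
     optimal_second strategies1 strategies2 (payoff A b C M) W"

end

theory Submission
  imports Defs
begin

text \<open>
  The game without the \<open>u\<close>-block is skew-symmetric, so a strongly optimal pair, normalised to trace
  one, is a good strategy for both players; the solution bound supplies such a pair that also
  is safe against the pure strategy \<open>u\<close>. Conversely, a strategy of the second player that holds the first player
  down to \<open>0\<close> satisfies the homogenised optimality system, because the cone of positive
  semidefinite matrices is self-dual, and that strategy rules out \<open>t = 0\<close>.
\<close>

section \<open>The trace inner product and the positive semidefinite cone\<close>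

definition outer :: "real^'n \<Rightarrow> real^'n^'n" where
  "outer v = (\<chi> i j. v $ i * v $ j)"

lemma mat_inner_eq: "mat_inner A B = (\<Sum>i\<in>UNIV. \<Sum>j\<in>UNIV. A $ i $ j * B $ j $ i)"
  by (simp add: mat_inner_def trace_def matrix_matrix_mult_def)

lemma mat_inner_commute: "mat_inner A B = mat_inner B A"
  unfolding mat_inner_def by (rule trace_mul_sym)

lemma linear_mat_inner_right: "linear (mat_inner A)"
proof (rule linearI)
  show "mat_inner A (X + Y) = mat_inner A X + mat_inner A Y" for X Y
    by (simp add: mat_inner_eq sum.distrib distrib_left)
  show "mat_inner A (c *\<^sub>R X) = c *\<^sub>R mat_inner A X" for c X
    by (simp add: mat_inner_eq sum_distrib_left mult.left_commute)
qed

lemmas mat_inner_right_simps =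
  linear_add[OF linear_mat_inner_right] linear_diff[OF linear_mat_inner_right]
  linear_cmul[OF linear_mat_inner_right] linear_sum[OF linear_mat_inner_right]

lemma linear_trace: "linear (trace :: real^'n^'n \<Rightarrow> real)"
  by (rule linearI) (simp_all add: trace_def sum.distrib sum_distrib_left)

text \<open>Rank-one matrices carry both halves of self-duality: as pivots peeled off in
  \<open>mat_inner_psd_nonneg\<close>, as test matrices in
  \<open>psd_if_mat_inner_nonneg\<close>.\<close>

lemma mat_inner_outer: "mat_inner A (outer v) = v \<bullet> (A *v v)"
  by (simp add: mat_inner_eq outer_def inner_vec_def matrix_vector_mult_def sum_distrib_left
      algebra_simps)

lemma trace_outer: "trace (outer v) = v \<bullet> v"
  by (simp add: trace_def outer_def inner_vec_def)

lemma sym_mat_nth: "sym_mat A \<Longrightarrow> A $ i $ j = A $ j $ i"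
  unfolding sym_mat_def by (metis transpose_def vec_lambda_beta)

lemma sym_matI: "(\<And>i j. A $ i $ j = A $ j $ i) \<Longrightarrow> sym_mat A"
  by (simp add: sym_mat_def transpose_def vec_eq_iff)

lemma outer_form: "x \<bullet> (outer v *v x) = (v \<bullet> x)\<^sup>2"
  by (simp add: outer_def inner_vec_def matrix_vector_mult_def power2_eq_square sum_product
      sum_distrib_left algebra_simps)

lemma psd_outer: "psd (outer v)"
  by (simp add: psd_def outer_form) (simp add: sym_matI outer_def)

lemma psd_scaleR: "psd A \<Longrightarrow> 0 \<le> c \<Longrightarrow> psd (c *\<^sub>R A)"
  by (auto simp: psd_def scaleR_matrix_vector_assoc[symmetric] sym_mat_def transpose_def vec_eq_iff)

section \<open>Entries, pivots and self-duality of positive semidefinite matrices\<close>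

lemma sym_bilinear:
  assumes "sym_mat B" shows "x \<bullet> (B *v z) = z \<bullet> (B *v x)"
proof -
  have "x \<bullet> (B *v z) = (transpose B *v x) \<bullet> z"
    by (metis dot_lmul_matrix transpose_matrix_vector)
  then show ?thesis using assms unfolding sym_mat_def by (metis inner_commute)
qed

lemma axis_form: "axis i (1::real) \<bullet> (B *v x) = (B *v x) $ i"
  by (simp add: inner_axis')

lemma matrix_axis: "(B *v axis k (1::real)) $ i = B $ i $ k"
  by (simp add: matrix_vector_mul_component inner_axis)

text \<open>This is the quadratic form expanded at \<open>x - c *\<^sub>R axis k 1\<close>. The
  facts on entries and pivots below are choices of \<open>x\<close> and \<open>c\<close> in
  it.\<close>

lemma psd_form_axis:
  assumes "psd B"
  shows "0 \<le> x \<bullet> (B *v x) - 2 * c * (B *v x) $ k + c\<^sup>2 * B $ k $ k"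
proof -
  let ?e = "axis k (1::real)"
  have s: "sym_mat B" using assms by (simp add: psd_def)
  have "0 \<le> (x - c *\<^sub>R ?e) \<bullet> (B *v (x - c *\<^sub>R ?e))"
    using assms by (simp add: psd_def)
  also have "\<dots> = x \<bullet> (B *v x) - c * (x \<bullet> (B *v ?e)) - c * (?e \<bullet> (B *v x))
      + c\<^sup>2 * (?e \<bullet> (B *v ?e))"
    by (simp add: matrix_vector_mult_diff_distrib matrix_vector_mult_scaleR inner_diff_left
        inner_diff_right power2_eq_square algebra_simps)
  finally show ?thesis
    by (simp add: sym_bilinear[OF s, of x ?e] axis_form matrix_axis)
qed

lemma psd_diag_nonneg: "psd B \<Longrightarrow> 0 \<le> B $ k $ k"
  using psd_form_axis[of B 0 1 k] by simp

lemma psd_entry_bound: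
  assumes "psd B" shows "2 * \<bar>B $ i $ j\<bar> \<le> B $ i $ i + B $ j $ j"
  \<comment> \<open>The two signs of \<open>c\<close> bound the entry from above and from
    below.\<close>
  using psd_form_axis[OF assms, of "axis j 1" 1 i] psd_form_axis[OF assms, of "axis j 1" "-1" i]
  by (simp add: axis_form matrix_axis)

lemma psd_zero_diag:
  assumes "psd B" "B $ k $ k = 0" shows "B $ k = 0"
proof -
  have "B $ k $ j = 0" for j
  proof (rule ccontr)
    let ?b = "B $ k $ j" and ?d = "B $ j $ j"
    assume nz: "?b \<noteq> 0"
    \<comment> \<open>With a zero diagonal entry the form is affine in \<open>c\<close>; this
      \<open>c\<close> is chosen to make it equal to -1.\<close>
    have "0 \<le> ?d - 2 * ((?d + 1) / (2 * ?b)) * ?b"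
      using psd_form_axis[OF assms(1), of "axis j 1" "(?d + 1) / (2 * ?b)" k] assms(2)
      by (simp add: axis_form matrix_axis)
    then show False using nz by simp
  qed
  then show ?thesis by (simp add: vec_eq_iff)
qed

text \<open>For fixed \<open>x\<close> the form in \<open>psd_form_axis\<close> is least at
  \<open>c = (B *v x) $ k / B $ k $ k\<close>, and this minimum is the quadratic form of the Schur
  complement.\<close>

lemma psd_pivot:
  assumes "psd B" "0 < B $ k $ k"
  shows "psd (B - (1 / B $ k $ k) *\<^sub>R outer (B $ k))"
proof -
  have s: "B $ i $ j = B $ j $ i" for i j
    using assms(1) sym_mat_nth by (auto simp: psd_def)
  have "0 \<le> x \<bullet> ((B - (1 / B $ k $ k) *\<^sub>R outer (B $ k)) *v x)" for x
    using psd_form_axis[OF assms(1), of x "(B *v x) $ k / B $ k $ k" k] assms(2)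
    by (simp add: matrix_vector_mult_diff_rdistrib inner_diff_right outer_form
        scaleR_matrix_vector_assoc[symmetric] matrix_vector_mul_component power2_eq_square)
  moreover have "sym_mat (B - (1 / B $ k $ k) *\<^sub>R outer (B $ k))"
    by (rule sym_matI) (simp add: outer_def s mult.commute)
  ultimately show ?thesis by (simp add: psd_def)
qed

text \<open>Splitting off a pivot replaces \<open>B\<close> by a Schur complement with fewer nonzero rows.\<close>

lemma mat_inner_psd_nonneg:
  assumes "psd A" "psd B" shows "0 \<le> mat_inner A B"
  using assms(2)
proof (induction "card {i. B $ i \<noteq> 0}" arbitrary: B rule: less_induct)
  case less
  show ?case
  proof (cases "B = 0")
    case True
    then show ?thesis by (simp add: mat_inner_eq)
  next
    case False
    then obtain k where k: "B $ k \<noteq> 0" by (auto simp: vec_eq_iff)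
    then have pos: "0 < B $ k $ k"
      using psd_zero_diag[OF less.prems, of k] psd_diag_nonneg[OF less.prems, of k]
      by (simp add: less_le) metis
    have s: "B $ i $ j = B $ j $ i" for i j
      using less.prems sym_mat_nth by (auto simp: psd_def)
    define B' where "B' = B - (1 / B $ k $ k) *\<^sub>R outer (B $ k)"
    have "B' $ k = 0"
      using pos by (simp add: B'_def vec_eq_iff outer_def)
    \<comment> \<open>A zero row stays zero: by symmetry its subtracted entries carry the factor
      \<open>B $ k $ i = B $ i $ k = 0\<close>. As row \<open>k\<close> vanishes too, the measure
      drops.\<close>
    moreover have "B' $ i = 0" if "B $ i = 0" for i
      using that by (simp add: B'_def vec_eq_iff outer_def s[of k i])
    ultimately have "{i. B' $ i \<noteq> 0} \<subset> {i. B $ i \<noteq> 0}"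
      using k by auto
    then have "0 \<le> mat_inner A B'"
      using less.hyps psd_pivot[OF less.prems pos] by (simp add: B'_def psubset_card_mono)
    moreover have "0 \<le> (1 / B $ k $ k) * mat_inner A (outer (B $ k))"
      using assms(1) pos by (simp add: mat_inner_outer psd_def)
    moreover have "mat_inner A B = mat_inner A B' + (1 / B $ k $ k) * mat_inner A (outer (B $ k))"
      by (simp add: B'_def mat_inner_right_simps)
    ultimately show ?thesis by linarith
  qed
qed

text \<open>Normalised rank-one matrices suffice as tests. They have trace one, so they are
  available as strategies of the first player.\<close>

lemma psd_if_mat_inner_nonneg:
  assumes "sym_mat B" and "\<And>X. psd X \<Longrightarrow> trace X = 1 \<Longrightarrow> 0 \<le> mat_inner X B"
  shows "psd B"
proof -
  have "0 \<le> x \<bullet> (B *v x)" for x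
  proof (cases "x = 0")
    case False
    let ?c = "1 / (x \<bullet> x)"
    have "0 \<le> mat_inner (?c *\<^sub>R outer x) B"
      using False by (intro assms(2) psd_scaleR psd_outer)
        (simp_all add: linear_cmul[OF linear_trace] trace_outer)
    also have "\<dots> = ?c * (x \<bullet> (B *v x))"
      by (simp add: mat_inner_commute[of _ B] mat_inner_right_simps mat_inner_outer)
    finally show ?thesis using False
      by (auto simp: zero_le_divide_iff dest: antisym[OF _ inner_ge_zero])
  qed simp
  with assms(1) show ?thesis by (simp add: psd_def)
qed

section \<open>Zero-sum games with bounded payoff\<close>

context
  fixes S :: "'s set" and T :: "'t set" and p :: "'s \<Rightarrow> 't \<Rightarrow> real" and K :: real
  assumes bound: "\<forall>x\<in>S. \<forall>y\<in>T. \<bar>p x y\<bar> \<le> K"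
begin

lemma bdd_above_payoff: "y \<in> T \<Longrightarrow> bdd_above ((\<lambda>x. p x y) ` S)"
  by (rule bdd_aboveI2[of _ _ K]) (use bound in force)

lemma bdd_below_payoff: "x \<in> S \<Longrightarrow> bdd_below (p x ` T)"
  by (rule bdd_belowI2[of _ "- K"]) (use bound in force)

lemma payoff_le_SUP: "x \<in> S \<Longrightarrow> y \<in> T \<Longrightarrow> p x y \<le> (SUP x\<in>S. p x y)"
  by (rule cSUP_upper) (auto intro: bdd_above_payoff)

text \<open>The guarantee of \<open>x0\<close> bounds both iterated values below by
  \<open>v\<close>, that of \<open>y0\<close> bounds both above. The bound \<open>K\<close> makes
  the real suprema and infima meaningful.\<close>

lemma has_game_value_saddle:
  assumes x0: "x0 \<in> S" "\<And>y. y \<in> T \<Longrightarrow> v \<le> p x0 y"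
    and y0: "y0 \<in> T" "\<And>x. x \<in> S \<Longrightarrow> p x y0 \<le> v"
  shows "has_game_value S T p v"
proof -
  have le: "(INF y\<in>T. p x y) \<le> v" if "x \<in> S" for x
    using cINF_lower[OF bdd_below_payoff[OF that] y0(1)] y0(2)[OF that] by linarith
  have ge: "v \<le> (SUP x\<in>S. p x y)" if "y \<in> T" for y
    using payoff_le_SUP[OF x0(1) that] x0(2)[OF that] by linarith
  have "max_min S T p = v"
    unfolding max_min_def
  proof (rule antisym)
    show "(SUP x\<in>S. INF y\<in>T. p x y) \<le> v"
      using x0(1) le by (intro cSUP_least) auto
    have "v \<le> (INF y\<in>T. p x0 y)"
      using y0(1) x0(2) by (intro cINF_greatest) auto
    also have "\<dots> \<le> (SUP x\<in>S. INF y\<in>T. p x y)"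
      using le by (intro cSUP_upper x0(1) bdd_aboveI2)
    finally show "v \<le> (SUP x\<in>S. INF y\<in>T. p x y)" .
  qed
  moreover have "min_max S T p = v"
    unfolding min_max_def
  proof (rule antisym)
    show "v \<le> (INF y\<in>T. SUP x\<in>S. p x y)"
      using y0(1) ge by (intro cINF_greatest) auto
    have "(INF y\<in>T. SUP x\<in>S. p x y) \<le> (SUP x\<in>S. p x y0)"
      using ge by (intro cINF_lower y0(1) bdd_belowI2)
    also have "\<dots> \<le> v"
      using x0(1) y0(2) by (intro cSUP_least) auto
    finally show "(INF y\<in>T. SUP x\<in>S. p x y) \<le> v" .
  qed
  ultimately show ?thesis by (simp add: has_game_value_def)
qed

end

text \<open>The game value is given by an infimum, while the converse direction requires an actual
  strategy. Near-minimisers subconverge in the compact set \<open>T\<close>, and continuity of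
  \<open>p x\<close> carries the inequality to the limit for each \<open>x\<close>
  separately.\<close>

lemma min_max_attained:
  fixes T :: "'t::metric_space set" and p :: "'s \<Rightarrow> 't \<Rightarrow> real"
  assumes bound: "\<forall>x\<in>S. \<forall>y\<in>T. \<bar>p x y\<bar> \<le> K"
    and "T \<noteq> {}" "compact T" and cont: "\<And>x. x \<in> S \<Longrightarrow> continuous_on T (p x)"
  shows "\<exists>y\<in>T. \<forall>x\<in>S. p x y \<le> min_max S T p"
proof -
  define v where "v = min_max S T p"
  have "\<exists>y\<in>T. (SUP x\<in>S. p x y) < v + 1 / real (Suc k)" for k
  proof -
    have "(INF y\<in>T. SUP x\<in>S. p x y) < v + 1 / real (Suc k)"
      by (simp add: v_def min_max_def)
    from cInf_lessD[OF _ this] show ?thesis using \<open>T \<noteq> {}\<close> by auto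
  qed
  then obtain f where f: "\<And>k. f k \<in> T" "\<And>k. (SUP x\<in>S. p x (f k)) < v + 1 / real (Suc k)"
    by metis
  obtain y r where y: "y \<in> T" and r: "strict_mono r" and lim: "(f \<circ> r) \<longlonglongrightarrow> y"
    using \<open>compact T\<close> f(1) unfolding compact_def by metis
  have "p x y \<le> v" if "x \<in> S" for x
  proof (rule LIMSEQ_le)
    show "(\<lambda>k. p x ((f \<circ> r) k)) \<longlonglongrightarrow> p x y"
      using continuous_on_tendsto_compose[OF cont[OF that] lim y] f(1) by simp
    show "(\<lambda>k. v + 1 / real (Suc (r k))) \<longlonglongrightarrow> v"
      using LIMSEQ_subseq_LIMSEQ[OF LIMSEQ_inverse_real_of_nat_add[of v] r]
      by (simp add: o_def inverse_eq_divide)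
    show "\<exists>N. \<forall>k\<ge>N. p x ((f \<circ> r) k) \<le> v + 1 / real (Suc (r k))"
      using payoff_le_SUP[OF bound that f(1)] f(2)
      by (metis comp_apply less_eq_real_def order.trans)
  qed
  with y show ?thesis by (auto simp: v_def)
qed

section \<open>The strategy sets\<close>

lemma trace_block_diag: "trace (block_diag P Q) = trace P + trace Q"
  by (simp add: trace_def block_diag_def UNIV_Plus_UNIV[symmetric] sum.Plus
      del: UNIV_Plus_UNIV)

lemma trace_diag3: "trace (diag3 X y t) = trace X + (\<Sum>i\<in>UNIV. y $ i) + t"
  unfolding diag3_def trace_block_diag by (simp add: trace_def diag_mat_def mat_def)

lemma trace_diag4: "trace (diag4 X y t u) = trace X + (\<Sum>i\<in>UNIV. y $ i) + t + u"
  unfolding diag4_def trace_block_diag by (simp add: trace_def diag_mat_def mat_def)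

section \<open>Continuity of the block-diagonal embeddings\<close>

lemma continuous_on_block_diag:
  fixes f :: "_ \<Rightarrow> real^'a::finite^'a" and g :: "_ \<Rightarrow> real^'b::finite^'b"
  assumes "continuous_on U f" "continuous_on U g"
  shows "continuous_on U (\<lambda>x. block_diag (f x) (g x))"
  unfolding block_diag_def
proof (intro continuous_on_vec_lambda)
  fix i :: "'a + 'b" and j :: "'a + 'b"
  show "continuous_on U (\<lambda>x. case (i, j) of (Inl k, Inl l) \<Rightarrow> f x $ k $ l
      | (Inr k, Inr l) \<Rightarrow> g x $ k $ l | _ \<Rightarrow> 0)"
    by (cases i; cases j) (auto intro!: continuous_intros assms)
qed

lemma continuous_on_diag_mat:
  assumes "continuous_on U f" shows "continuous_on U (\<lambda>x. diag_mat (f x))"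
  unfolding diag_mat_def
proof (intro continuous_on_vec_lambda)
  fix i j show "continuous_on U (\<lambda>x. if i = j then f x $ i else 0)"
    by (cases "i = j") (auto intro!: continuous_intros assms)
qed

lemma continuous_on_mat:
  fixes f :: "_ \<Rightarrow> real"
  assumes "continuous_on U f" shows "continuous_on U (\<lambda>x. mat (f x) :: real^'k^'k)"
  unfolding mat_def
proof (intro continuous_on_vec_lambda)
  fix i j :: 'k show "continuous_on U (\<lambda>x. if i = j then f x else 0)"
    by (cases "i = j") (auto intro!: continuous_intros assms)
qed

section \<open>Compactness of the strategy sets\<close>

lemma closed_psd: "closed {X :: real^'n^'n. psd X}"
  unfolding psd_def sym_mat_def transpose_def vec_eq_iff inner_vec_def matrix_vector_mult_def
  by (simp, intro closed_Collect_conj closed_Collect_all closed_Collect_eq closed_Collect_le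
      continuous_intros)

lemma trace_psd_nonneg: "psd X \<Longrightarrow> 0 \<le> trace X"
  by (auto simp: trace_def intro!: sum_nonneg psd_diag_nonneg)

lemma norm_vec_le_card:
  fixes x :: "'a::real_normed_vector^'n"
  assumes "\<And>i. norm (x $ i) \<le> c" shows "norm x \<le> of_nat CARD('n) * c"
proof -
  have "norm x \<le> (\<Sum>i\<in>UNIV. norm (x $ i))"
    unfolding norm_vec_def by (rule L2_set_le_sum) simp
  also have "\<dots> \<le> of_nat CARD('n) * c"
    using assms by (intro sum_bounded_above)
  finally show ?thesis .
qed

text \<open>Diagonal entries are nonnegative and sum to the trace, and
  \<open>psd_entry_bound\<close> extends their bound to all entries. Each of the two index levels
  costs one factor \<open>CARD('n)\<close>.\<close>

lemma norm_psd_le: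
  fixes X :: "real^'n^'n"
  assumes "psd X" shows "norm X \<le> of_nat CARD('n) * (of_nat CARD('n) * trace X)"
proof (intro norm_vec_le_card)
  fix i j
  have "X $ k $ k \<le> trace X" for k
    unfolding trace_def using assms by (intro member_le_sum psd_diag_nonneg) auto
  from this[of i] this[of j] show "norm (X $ i $ j) \<le> trace X"
    using psd_entry_bound[OF assms, of i j] by simp
qed

lemma norm_nonneg_vec_le:
  fixes y :: "real^'m"
  assumes "nonneg_vec y" shows "norm y \<le> of_nat CARD('m) * (\<Sum>i\<in>UNIV. y $ i)"
  using assms unfolding nonneg_vec_def
  by (intro norm_vec_le_card) (auto intro: member_le_sum)

text \<open>A common parameter space for both players: \<open>diag4\<close> maps it onto the first
  strategy set, and \<open>diag3\<close> maps its slice \<open>u = 0\<close> onto the second, so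
  compactness is proved once.\<close>

definition weights :: "((real^'n^'n) \<times> (real^'m) \<times> real \<times> real) set" where
  "weights = {(X, y, t, u). psd X \<and> nonneg_vec y \<and> 0 \<le> t \<and> 0 \<le> u \<and>
     trace X + (\<Sum>i\<in>UNIV. y $ i) + t + u = 1}"

lemma compact_weights: "compact (weights :: ((real^'n^'n) \<times> (real^'m) \<times> real \<times> real) set)"
proof -
  let ?W = "weights :: ((real^'n^'n) \<times> (real^'m) \<times> real \<times> real) set"
  let ?n = "real CARD('n)" and ?m = "real CARD('m)"
  \<comment> \<open>In terms of projections, every condition is a closed one on continuous functions
    of \<open>z\<close>.\<close>
  have eq: "?W = {z. fst z \<in> Collect psd \<and> (\<forall>i. 0 \<le> fst (snd z) $ i) \<and> 0 \<le> fst (snd (snd z)) \<and>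
      0 \<le> snd (snd (snd z)) \<and>
      (\<Sum>i\<in>UNIV. fst z $ i $ i) + (\<Sum>i\<in>UNIV. fst (snd z) $ i) + fst (snd (snd z)) + snd (snd (snd z)) = 1}"
    by (auto simp: weights_def nonneg_vec_def trace_def)
  have "closed {z :: (real^'n^'n) \<times> (real^'m) \<times> real \<times> real. fst z \<in> Collect psd}"
    using closed_vimage[OF closed_psd, of fst] by (simp add: vimage_def continuous_on_fst)
  then have "closed ?W"
    unfolding eq
    by (intro closed_Collect_conj closed_Collect_all closed_Collect_eq closed_Collect_le
        continuous_intros)
  \<comment> \<open>The radii are the norm bounds above with trace and coordinate sum at most
    1.\<close>
  moreover have "?W \<subseteq> cball 0 (?n * ?n) \<times> cball 0 ?m \<times> cball 0 1 \<times> cball 0 1"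
  proof
    fix z assume "z \<in> ?W"
    then obtain X y t u where z: "z = (X, y, t, u)" and w: "psd X" "nonneg_vec y" "0 \<le> t" "0 \<le> u"
      "trace X + (\<Sum>i\<in>UNIV. y $ i) + t + u = 1"
      by (auto simp: weights_def)
    have nn: "0 \<le> trace X" "0 \<le> (\<Sum>i\<in>UNIV. y $ i)"
      using w by (auto intro: trace_psd_nonneg sum_nonneg simp: nonneg_vec_def)
    have "norm X \<le> ?n * (?n * trace X)" by (rule norm_psd_le[OF w(1)])
    also have "\<dots> \<le> ?n * (?n * 1)"
      using w nn by (intro mult_left_mono) auto
    finally have X: "norm X \<le> ?n * ?n" by simp
    have "norm y \<le> ?m * (\<Sum>i\<in>UNIV. y $ i)" by (rule norm_nonneg_vec_le[OF w(2)])
    also have "\<dots> \<le> ?m * 1"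
      using w nn by (intro mult_left_mono) auto
    finally have "norm y \<le> ?m" by simp
    with X show "z \<in> cball 0 (?n * ?n) \<times> cball 0 ?m \<times> cball 0 1 \<times> cball 0 1"
      using w nn by (simp add: z)
  qed
  then have "bounded ?W"
    by (rule bounded_subset[rotated]) (intro bounded_Times bounded_cball)
  ultimately show ?thesis by (simp add: compact_eq_bounded_closed)
qed

lemma compact_strategies1: "compact strategies1" (is "compact ?S")
proof -
  have "?S = (\<lambda>z. diag4 (fst z) (fst (snd z)) (fst (snd (snd z))) (snd (snd (snd z)))) ` weights"
    unfolding strategies1_def weights_def trace_diag4 set_eq_iff image_iff Bex_def split_paired_Ex
    by simp blast
  moreover have "compact \<dots>"
    unfolding diag4_def
    by (intro compact_continuous_image compact_weights continuous_on_block_diag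
        continuous_on_diag_mat continuous_on_mat continuous_intros)
  ultimately show ?thesis by simp
qed

lemma compact_strategies2: "compact strategies2" (is "compact ?S")
proof -
  have "?S = (\<lambda>z. diag3 (fst z) (fst (snd z)) (fst (snd (snd z))))
      ` (weights \<inter> {z. snd (snd (snd z)) = 0})"
    unfolding strategies2_def weights_def trace_diag3 set_eq_iff image_iff Bex_def split_paired_Ex
    by simp blast
  moreover have "compact \<dots>"
    unfolding diag3_def
    by (intro compact_continuous_image compact_Int_closed compact_weights closed_Collect_eq
        continuous_on_block_diag continuous_on_diag_mat continuous_on_mat continuous_intros)
  ultimately show ?thesis by simp
qed

section \<open>Joint continuity and boundedness of the payoff\<close>

lemma continuous_on_payoff:
  "continuous_on U (\<lambda>z. payoff A b C M (fst z) (snd z))"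
  \<comment> \<open>Written out in entries, the payoff is a polynomial in those of both
    matrices.\<close>
  unfolding payoff_def Let_def mat_inner_eq trace_def X_part_def y_part_def t_part3_def
    t_part4_def u_part4_def inner_vec_def
  by (simp add: sum_distrib_left) (intro continuous_intros)

lemma payoff_bounded: "\<exists>K. \<forall>Z\<in>strategies1. \<forall>W\<in>strategies2. \<bar>payoff A b C M Z W\<bar> \<le> K"
proof -
  have "bounded ((\<lambda>z. payoff A b C M (fst z) (snd z)) ` (strategies1 \<times> strategies2))"
    by (intro compact_imp_bounded compact_continuous_image continuous_on_payoff compact_Times
        compact_strategies1 compact_strategies2)
  then obtain K where "\<forall>z\<in>strategies1 \<times> strategies2. \<bar>payoff A b C M (fst z) (snd z)\<bar> \<le> K"
    by (auto simp: bounded_iff)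
  then show ?thesis by (intro exI[of _ K]) force
qed

section \<open>Strongly optimal pairs and optimal strategies\<close>

lemma payoff_diag:
  "payoff A b C M (diag4 X y t u) (diag3 X' y' t') =
     (\<Sum>i\<in>UNIV. y $ i * (t' * b $ i - mat_inner (A i) X'))
     + mat_inner X ((\<Sum>i\<in>UNIV. y' $ i *\<^sub>R A i) - t' *\<^sub>R C)
     + t * (mat_inner C X' - b \<bullet> y')
     + u * (trace X' + (\<Sum>i\<in>UNIV. y' $ i) - t' * M)"
  by (simp add: payoff_def)

text \<open>Once products are expanded, exchanging the players permutes the six bilinear terms and
  flips their signs. A guarantee for the second player thereby becomes one for the first.\<close>

lemma payoff_skew:
  "payoff A b C M (diag4 X y t 0) (diag3 X' y' t') =
   - payoff A b C M (diag4 X' y' t' 0) (diag3 X y t)"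
proof -
  have "(\<Sum>i\<in>UNIV. y $ i * (t' * b $ i - mat_inner (A i) X')) =
      t' * (b \<bullet> y) - (\<Sum>i\<in>UNIV. y $ i * mat_inner X' (A i))" for y t' X'
    by (simp add: right_diff_distrib sum_subtractf inner_vec_def sum_distrib_left
        mult.left_commute mult.commute mat_inner_commute[of X'])
  then show ?thesis
    by (simp add: payoff_diag mat_inner_right_simps mat_inner_commute[of C] right_diff_distrib)
qed

section \<open>The auxiliary problem and the homogenised optimality system\<close>

lemma strongly_optimal_iff_aux_feasible:
  "strongly_optimal A b C X y \<longleftrightarrow> aux_feasible A b C X y 0"
  by (auto simp: strongly_optimal_def aux_feasible_def primal_feasible_def dual_feasible_def)

text \<open>A strongly optimal pair attains \<open>w = 0\<close>, the least value that the
  constraint \<open>0 \<le> w\<close> permits. Hence the infimum is attained, and the optimal point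
  that \<open>M\<close> bounds has \<open>w = 0\<close> as well; it may differ from the given
  pair.\<close>

lemma strongly_optimal_bounded:
  assumes "solution_bound A b C M" "strongly_optimal A b C X y"
  obtains X' y' where "strongly_optimal A b C X' y'" "trace X' + (\<Sum>i\<in>UNIV. y' $ i) + 1 \<le> M"
proof -
  have f: "aux_feasible A b C X y 0"
    using assms(2) by (simp add: strongly_optimal_iff_aux_feasible)
  then have "aux_optimal A b C X y 0"
    by (simp add: aux_optimal_def aux_feasible_def)
  then obtain X' y' w where o: "aux_optimal A b C X' y' w"
    and b: "trace X' + (\<Sum>i\<in>UNIV. y' $ i) + 1 \<le> M"
    using assms(1) unfolding solution_bound_def by blast
  have "w = 0"
    using o f by (intro antisym) (auto simp: aux_optimal_def aux_feasible_def)
  with o have "strongly_optimal A b C X' y'"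
    by (simp add: aux_optimal_def strongly_optimal_iff_aux_feasible)
  with b that show thesis by blast
qed

text \<open>The data \<open>b\<close> and \<open>C\<close> are multiplied by \<open>t\<close>, which
  makes the solutions a cone. They can be rescaled to trace one for strategies, or to
  \<open>t = 1\<close> for optimal pairs when \<open>t\<close> is positive.\<close>

definition homogeneous_optimal where
  "homogeneous_optimal A b C X y t \<longleftrightarrow>
     psd X \<and> nonneg_vec y \<and> 0 \<le> t \<and> (\<forall>i. t * b $ i \<le> mat_inner (A i) X) \<and>
     (\<Sum>i\<in>UNIV. y $ i *\<^sub>R A i) \<preceq>\<^sub>L t *\<^sub>R C \<and> mat_inner C X \<le> b \<bullet> y"

lemma homogeneous_optimal_scaleR:
  assumes "homogeneous_optimal A b C X y t" "0 \<le> c"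
  shows "homogeneous_optimal A b C (c *\<^sub>R X) (c *\<^sub>R y) (c * t)"
proof -
  have "psd (c *\<^sub>R (t *\<^sub>R C - (\<Sum>i\<in>UNIV. y $ i *\<^sub>R A i)))"
    using assms by (intro psd_scaleR) (auto simp: homogeneous_optimal_def loewner_le_def)
  then have "(\<Sum>i\<in>UNIV. (c *\<^sub>R y) $ i *\<^sub>R A i) \<preceq>\<^sub>L (c * t) *\<^sub>R C"
    by (simp add: loewner_le_def scaleR_sum_right algebra_simps)
  with assms show ?thesis
    by (auto simp: homogeneous_optimal_def mat_inner_right_simps psd_scaleR nonneg_vec_def
        mult.assoc intro!: mult_left_mono)
qed

lemma strongly_optimal_iff_homogeneous:
  "strongly_optimal A b C X y \<longleftrightarrow> homogeneous_optimal A b C X y 1"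
  by (auto simp: strongly_optimal_def primal_feasible_def dual_feasible_def
      homogeneous_optimal_def)

text \<open>Each block of the first player multiplies one constraint of the system; self-duality
  handles the matrix block. The condition on \<open>u\<close> is a product so as to cover both
  \<open>u = 0\<close> and a nonnegative \<open>u\<close> under the bound
  \<open>t * M\<close>.\<close>

lemma homogeneous_payoff_nonpos:
  assumes opt: "homogeneous_optimal A b C X y t"
    and u: "u * (trace X + (\<Sum>i\<in>UNIV. y $ i) - t * M) \<le> 0"
    and s: "psd X'" "nonneg_vec y'" "0 \<le> t'"
  shows "payoff A b C M (diag4 X' y' t' u) (diag3 X y t) \<le> 0"
proof -
  have "(\<Sum>i\<in>UNIV. y' $ i * (t * b $ i - mat_inner (A i) X)) \<le> 0"
    using opt s by (intro sum_nonpos mult_nonneg_nonpos)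
      (auto simp: nonneg_vec_def homogeneous_optimal_def)
  moreover have "0 \<le> mat_inner X' (t *\<^sub>R C - (\<Sum>i\<in>UNIV. y $ i *\<^sub>R A i))"
    using opt s by (intro mat_inner_psd_nonneg) (auto simp: homogeneous_optimal_def loewner_le_def)
  moreover have "t' * (mat_inner C X - b \<bullet> y) \<le> 0"
    using opt s by (intro mult_nonneg_nonpos) (auto simp: homogeneous_optimal_def)
  ultimately show ?thesis
    using u by (simp add: payoff_diag mat_inner_right_simps)
qed

section \<open>From strategies of the second player to strongly optimal pairs\<close>

lemma diag3_in_strategies2:
  "diag3 X y t \<in> strategies2 \<longleftrightarrow>
     psd X \<and> nonneg_vec y \<and> 0 \<le> t \<and> trace X + (\<Sum>i\<in>UNIV. y $ i) + t = 1"
  unfolding strategies2_def trace_diag3 by simp (metis parts_diag3)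

lemma diag4_in_strategies1:
  "diag4 X y t u \<in> strategies1 \<longleftrightarrow>
     psd X \<and> nonneg_vec y \<and> 0 \<le> t \<and> 0 \<le> u \<and> trace X + (\<Sum>i\<in>UNIV. y $ i) + t + u = 1"
  unfolding strategies1_def trace_diag4 by simp (metis parts_diag4)

lemma psd_0: "psd 0" and nonneg_vec_0: "nonneg_vec 0"
  by (simp_all add: psd_def nonneg_vec_def sym_mat_def transpose_def vec_eq_iff)

lemma trace_0: "trace (0 :: real^'n^'n) = 0"
  by (rule linear_0[OF linear_trace])

text \<open>A first-player strategy concentrated on a single block isolates the corresponding
  constraint.\<close>

lemma payoff_nonpos_homogeneous:
  fixes A :: "'m::finite \<Rightarrow> real^'n::finite^'n"
  assumes sym: "\<And>i. sym_mat (A i)" "sym_mat C"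
    and W: "diag3 X y t \<in> strategies2"
    and le: "\<And>Z. Z \<in> strategies1 \<Longrightarrow> payoff A b C M Z (diag3 X y t) \<le> 0"
  shows "homogeneous_optimal A b C X y t" "0 < t"
proof -
  note [simp] = diag4_in_strategies1 psd_0 nonneg_vec_0 trace_0 payoff_diag mat_inner_eq[of 0]
  have W': "psd X" "nonneg_vec y" "0 \<le> t" "trace X + (\<Sum>i\<in>UNIV. y $ i) + t = 1"
    using W by (auto simp: diag3_in_strategies2)
  have "t * b $ i \<le> mat_inner (A i) X" for i
  proof -
    have "diag4 0 (axis i 1) 0 0 \<in> strategies1"
      by (simp add: nonneg_vec_def axis_def)
    from le[OF this] show ?thesis
      by (simp add: axis_def if_distrib[of "\<lambda>x. x * _"] cong: if_cong)
  qed
  moreover have "psd (t *\<^sub>R C - (\<Sum>i\<in>UNIV. y $ i *\<^sub>R A i))"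
  proof (rule psd_if_mat_inner_nonneg)
    \<comment> \<open>The tests control only the quadratic form; symmetry of the slack matrix is
      inherited from the data.\<close>
    show "sym_mat (t *\<^sub>R C - (\<Sum>i\<in>UNIV. y $ i *\<^sub>R A i))"
    proof (rule sym_matI)
      fix j k
      show "(t *\<^sub>R C - (\<Sum>i\<in>UNIV. y $ i *\<^sub>R A i)) $ j $ k =
          (t *\<^sub>R C - (\<Sum>i\<in>UNIV. y $ i *\<^sub>R A i)) $ k $ j"
        by (simp add: sum_component sym_mat_nth[OF sym(1), of _ j k] sym_mat_nth[OF sym(2), of j k])
    qed
    fix X' :: "real^'n^'n" assume "psd X'" "trace X' = 1"
    then have "diag4 X' (0 :: real^'m) 0 0 \<in> strategies1" by simp
    from le[OF this] show "0 \<le> mat_inner X' (t *\<^sub>R C - (\<Sum>i\<in>UNIV. y $ i *\<^sub>R A i))"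
      by (simp add: mat_inner_right_simps)
  qed
  moreover have "mat_inner C X \<le> b \<bullet> y"
    using le[of "diag4 0 0 1 0"] by simp
  ultimately show "homogeneous_optimal A b C X y t"
    using W' by (simp add: homogeneous_optimal_def loewner_le_def)
  have "trace X + (\<Sum>i\<in>UNIV. y $ i) \<le> t * M"
    using le[of "diag4 0 0 0 1"] by simp
  \<comment> \<open>At \<open>t = 0\<close> the bound from the pure strategy \<open>u\<close> would
    read \<open>1 \<le> 0\<close>, since the total trace is one.\<close>
  with W'(3,4) show "0 < t"
    by (cases "t = 0") auto
qed

lemma payoff_nonpos_strongly_optimal:
  assumes "\<And>i. sym_mat (A i)" "sym_mat C" and W: "W \<in> strategies2"
    and "\<And>Z. Z \<in> strategies1 \<Longrightarrow> payoff A b C M Z W \<le> 0"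
  shows "\<exists>X y t. W = diag3 X y t \<and> 0 < t \<and>
    strongly_optimal A b C ((1 / t) *\<^sub>R X) ((1 / t) *\<^sub>R y)"
proof -
  obtain X y t where eq: "W = diag3 X y t" using W by (auto simp: strategies2_def)
  note h = payoff_nonpos_homogeneous[OF assms[unfolded eq]]
  have "strongly_optimal A b C ((1 / t) *\<^sub>R X) ((1 / t) *\<^sub>R y)"
    using homogeneous_optimal_scaleR[OF h(1), of "1 / t"] h(2)
    by (simp add: strongly_optimal_iff_homogeneous)
  with eq h(2) show ?thesis by blast
qed

lemma dantzig_game_value_0:
  assumes bound: "solution_bound A b C M" and opt: "strongly_optimal A b C X0 y0"
  shows "dantzig_game_value A b C M 0"
proof -
  obtain X y where so: "strongly_optimal A b C X y" and M: "trace X + (\<Sum>i\<in>UNIV. y $ i) + 1 \<le> M"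
    using strongly_optimal_bounded[OF bound opt] .
  \<comment> \<open>This is the trace of \<open>diag3 X y 1\<close>, so division by \<open>s\<close>
    yields a strategy.\<close>
  define s where "s = trace X + (\<Sum>i\<in>UNIV. y $ i) + 1"
  have h: "homogeneous_optimal A b C X y 1"
    using so by (simp add: strongly_optimal_iff_homogeneous)
  then have "0 \<le> trace X" "0 \<le> (\<Sum>i\<in>UNIV. y $ i)"
    by (auto intro: trace_psd_nonneg sum_nonneg simp: nonneg_vec_def homogeneous_optimal_def)
  then have s: "0 < s" by (simp add: s_def)
  define X' y' t' where "X' = (1 / s) *\<^sub>R X" and "y' = (1 / s) *\<^sub>R y" and "t' = 1 / s"
  have h': "homogeneous_optimal A b C X' y' t'"
    using homogeneous_optimal_scaleR[OF h, of "1 / s"] s by (simp add: X'_def y'_def t'_def)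
  have sums: "trace X' = trace X / s" "(\<Sum>i\<in>UNIV. y' $ i) = (\<Sum>i\<in>UNIV. y $ i) / s"
    by (simp_all add: X'_def y'_def linear_cmul[OF linear_trace] sum_divide_distrib)
  have one: "trace X' + (\<Sum>i\<in>UNIV. y' $ i) + t' = 1"
    using s by (simp add: sums t'_def add_divide_distrib[symmetric] s_def[symmetric])
  \<comment> \<open>Over the denominator \<open>s\<close> the numerator is \<open>s - 1 - M\<close>,
    negative because \<open>s \<le> M\<close>.\<close>
  have col: "trace X' + (\<Sum>i\<in>UNIV. y' $ i) - t' * M \<le> 0"
    using s M by (simp add: sums t'_def add_divide_distrib[symmetric] diff_divide_distrib[symmetric]
        divide_le_0_iff)
  obtain K where K: "\<forall>Z\<in>strategies1. \<forall>W\<in>strategies2. \<bar>payoff A b C M Z W\<bar> \<le> K"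
    using payoff_bounded[of A b C M] by blast
  show ?thesis
    unfolding dantzig_game_value_def
  proof (rule has_game_value_saddle[OF K])
    show "diag4 X' y' t' 0 \<in> strategies1" "diag3 X' y' t' \<in> strategies2"
      using h' one by (auto simp: diag4_in_strategies1 diag3_in_strategies2 homogeneous_optimal_def)
    \<comment> \<open>With \<open>u = 0\<close> the first player copies the second, and
      skew-symmetry applies.\<close>
    show "0 \<le> payoff A b C M (diag4 X' y' t' 0) W" if "W \<in> strategies2" for W
      using that h' by (auto simp: strategies2_def payoff_skew[of A b C M X']
          intro!: homogeneous_payoff_nonpos)
    show "payoff A b C M Z (diag3 X' y' t') \<le> 0" if "Z \<in> strategies1" for Z
      using that h' col by (auto simp: strategies1_def intro!: homogeneous_payoff_nonpos
          mult_nonneg_nonpos)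
  qed
qed

theorem theorem3p6:
  fixes A :: "'m::finite \<Rightarrow> real^'n::finite^'n"
    and b :: "real^'m"
    and C :: "real^'n^'n"
    and M :: real
  assumes "\<And>i. sym_mat (A i)"
    and "sym_mat C"
    and "solution_bound A b C M"
  shows "((\<exists>X y. strongly_optimal A b C X y) \<longleftrightarrow> dantzig_game_value A b C M 0) \<and>
    (dantzig_game_value A b C M 0 \<longrightarrow>
      (\<forall>W. dantzig_optimal_second A b C M W \<longrightarrow>
        (\<exists>X y t. W = diag3 X y t \<and> 0 < t \<and>
          strongly_optimal A b C ((1 / t) *\<^sub>R X) ((1 / t) *\<^sub>R y))))"
proof (intro conjI iffI impI allI)
  let ?S = "strategies1 :: (real^('n + 'm + 1 + 1)^('n + 'm + 1 + 1)) set"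
    and ?T = "strategies2 :: (real^('n + 'm + 1)^('n + 'm + 1)) set"
    and ?p = "payoff A b C M"
  obtain K where K: "\<forall>Z\<in>?S. \<forall>W\<in>?T. \<bar>?p Z W\<bar> \<le> K"
    using payoff_bounded[of A b C M] by blast
  show "dantzig_game_value A b C M 0" if "\<exists>X y. strongly_optimal A b C X y"
    using that dantzig_game_value_0[OF assms(3)] by blast
  \<comment> \<open>Both remaining claims start from value zero and reduce to a strategy of the
    second player that keeps every payoff at most 0: a minimiser for existence, the given
    \<open>W\<close> for the last claim.\<close>
  {
    assume val: "dantzig_game_value A b C M 0"
    then have mm: "min_max ?S ?T ?p = 0"
      by (simp add: dantzig_game_value_def has_game_value_def)
    have "diag3 0 0 1 \<in> ?T"
      by (simp add: diag3_in_strategies2 psd_0 nonneg_vec_0 trace_0)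
    then have ne: "?T \<noteq> {}" by blast
    have cont: "continuous_on ?T (?p Z)" for Z
      using continuous_on_compose2[OF continuous_on_payoff[of UNIV A b C M],
          OF continuous_on_Pair[OF continuous_on_const continuous_on_id], of Z ?T]
      by simp
    obtain W where "W \<in> ?T" "\<forall>Z\<in>?S. ?p Z W \<le> 0"
      using min_max_attained[OF K ne compact_strategies2 cont] unfolding mm by blast
    then show "\<exists>X y. strongly_optimal A b C X y"
      using payoff_nonpos_strongly_optimal[where A = A, OF assms(1,2)] by blast
    fix W assume "dantzig_optimal_second A b C M W"
    then have W: "W \<in> ?T" "(SUP Z\<in>?S. ?p Z W) = 0"
      by (auto simp: dantzig_optimal_second_def optimal_second_def mm)
    then have "?p Z W \<le> 0" if "Z \<in> ?S" for Z
      using payoff_le_SUP[OF K that W(1)] by simp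
    then show "\<exists>X y t. W = diag3 X y t \<and> 0 < t \<and>
        strongly_optimal A b C ((1 / t) *\<^sub>R X) ((1 / t) *\<^sub>R y)"
      by (rule payoff_nonpos_strongly_optimal[where A = A, OF assms(1,2) W(1)])
  }
qed

end
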